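(* Let $f:\mathbb{R}^d\to\mathbb{R}$ be a (possibly non-convex) function that is bounded below, $L$-smooth on $\mathbb{R}^d$, and upper bounded by $f_{\max}$, i.e. $f(x)\le f_{\max}$ for all $x\in\mathbb{R}^d$. Suppose the stochastic gradient oracle is unbiased and variance-bounded by $V^2$. Let $T>1$ be an integer, $\beta\in[1,T)$, $\alpha=(\beta/T)^{-1/T}$, $0<\eta_0\le 1/L$, and $x_1\in\mathbb{R}^d$ arbitrary. Run SGD, $x_{t+1}=x_t-\eta_t\hat g_t$ for $t=1,\dots,T$, with the exponentially decaying step-size $\eta_t=\eta_0/\alpha^{t}$, and let $\hat x_T$ be drawn at random from $\{x_t\}_{t=1}^T$ with probabilities $P_t=\frac{1/\eta_t}{\sum_{l=1}^T 1/\eta_l}$. Then $$\mathbb{E}\big[\|\nabla f(\hat x_T)\|^2\big]\le\frac{\eta_0\ln(\frac{T}{\beta})}{(\frac{T}{\beta}-1)T}\left[\frac{2f_{\max}}{\eta_0^2}\left(\frac{T}{\beta}\right)^2+LV^2T\right].$$ In particular, $\beta=\sqrt{T}$ yields $$\mathbb{E}\big[\|\nabla f(\hat x_T)\|^2\big]\le\left(\frac{f_{\max}}{\eta_0}+\frac{LV^2\eta_0}{2}\right)\cdot\frac{\ln T}{\sqrt{T}-1}.$$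
   Context: $\|\cdot\|$ is the Euclidean norm. $f$ is $L$-smooth on $\mathbb{R}^d$ ($L>0$) if it is differentiable and $\|\nabla f(x)-\nabla f(y)\|\le L\|x-y\|$ for all $x,y\in\mathbb{R}^d$. Stochastic gradient oracle: queried at $x_t$ it returns a random vector $\hat g_t$ which (conditionally on the past of the algorithm) satisfies $\mathbb{E}[\hat g_t]=\nabla f(x_t)$. It is variance-bounded by $V^2$ if for every input, $\mathbb{E}[\|\hat g-\mathbb{E}[\hat g]\|^2]\le V^2$. The random index defining $\hat x_T$ is chosen independently of the run, and the expectation is over both the oracle randomness and this choice.
   Formalization: Both bounds with f_max are proved for f ≥ 0; for general f bounded below, f_max is replaced by f_max − inf f, since the claim as stated fails (e.g. f(y) = sin y − 1, f_max = 0, V = 0, x_1 = 0, where the right side is 0). *)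

theory Defs
  imports "HOL-Probability.Probability"
begin

definition grad :: "('a::real_inner \<Rightarrow> real) \<Rightarrow> 'a \<Rightarrow> 'a" where
  "grad f x = (THE D. GDERIV f x :> D)"

lemma GDERIV_grad:
  fixes f :: "'a::euclidean_space \<Rightarrow> real"
  assumes "f differentiable (at x)"
  shows "GDERIV f x :> grad f x"
proof -
  obtain f' where f': "(f has_derivative f') (at x)"
    using assms unfolding differentiable_def by blast
  then have lin: "linear f'"
    by (rule has_derivative_linear)
  define D where "D = (\<Sum>b\<in>Basis. f' b *\<^sub>R b)"
  have "f' h = h \<bullet> D" for h
  proof -
    have "f' h = f' (\<Sum>b\<in>Basis. (h \<bullet> b) *\<^sub>R b)"
      by (simp add: euclidean_representation)
    also have "\<dots> = (\<Sum>b\<in>Basis. (h \<bullet> b) * f' b)"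
      using lin by (simp add: linear_sum linear_scale)
    also have "\<dots> = h \<bullet> D"
      by (simp add: D_def inner_sum_right mult.commute)
    finally show ?thesis .
  qed
  then have "f' = (\<lambda>h. h \<bullet> D)"
    by (rule ext)
  with f' have D: "GDERIV f x :> D"
    by (simp add: gderiv_def)
  have "E = D" if "GDERIV f x :> E" for E
  proof -
    have "(\<lambda>h. h \<bullet> E) = (\<lambda>h. h \<bullet> D)"
      using that D unfolding gderiv_def by (rule has_derivative_unique)
    then show ?thesis
      by (metis inner_commute vector_eq_rdot)
  qed
  with D show ?thesis
    unfolding grad_def by (metis theI)
qed

definition smooth_on_space :: "real \<Rightarrow> ('a::euclidean_space \<Rightarrow> real) \<Rightarrow> bool" where
  "smooth_on_space L f \<longleftrightarrow>
     (\<forall>x. f differentiable (at x)) \<and>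
     (\<forall>x y. norm (grad f x - grad f y) \<le> L * norm (x - y))"

text \<open>Conditional expectation of a random vector, taken coordinatewise.\<close>

definition vec_cond_exp ::
    "'a measure \<Rightarrow> 'a measure \<Rightarrow> ('a \<Rightarrow> 'b::euclidean_space) \<Rightarrow> 'a \<Rightarrow> 'b" where
  "vec_cond_exp M F X = (\<lambda>\<omega>. \<Sum>b\<in>Basis. real_cond_exp M F (\<lambda>\<omega>'. X \<omega>' \<bullet> b) \<omega> *\<^sub>R b)"

text \<open>
  What the algorithm has seen before query \<open>t\<close>: the oracle answers \<open>g 1, \<dots>, g (t - 1)\<close>
  (the starting point is deterministic, so for \<open>t = 1\<close> this is the trivial sigma-algebra).
\<close>

definition past :: "'a measure \<Rightarrow> (nat \<Rightarrow> 'a \<Rightarrow> 'b::euclidean_space) \<Rightarrow> nat \<Rightarrow> 'a measure" where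
  "past M g t = sigma (space M) (\<Union>i\<in>{1..<t}. {g i -` A \<inter> space M | A. A \<in> sets borel})"

lemma subalgebra_past:
  assumes "\<And>i. 1 \<le> i \<Longrightarrow> i < t \<Longrightarrow> g i \<in> borel_measurable M"
  shows "subalgebra M (past M g t)"
proof -
  let ?G = "\<Union>i\<in>{1..<t}. {g i -` A \<inter> space M | A. A \<in> sets borel}"
  have "?G \<subseteq> Pow (space M)" by auto
  moreover have "?G \<subseteq> sets M"
    using assms by (auto intro: measurable_sets)
  ultimately show ?thesis
    unfolding subalgebra_def past_def
    by (simp add: space_measure_of_conv sets.sigma_sets_subset)
qed

text \<open>Integrability is required because the conditional expectation is total in the library.\<close>

definition unbiased_oracle ::
    "'a measure \<Rightarrow> ('b::euclidean_space \<Rightarrow> real) \<Rightarrow> (nat \<Rightarrow> 'a \<Rightarrow> 'b) \<Rightarrow> (nat \<Rightarrow> 'a \<Rightarrow> 'b) \<Rightarrow> nat \<Rightarrow> bool"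
  where
  "unbiased_oracle M f x g T \<longleftrightarrow>
     (\<forall>t\<in>{1..T}. integrable M (g t) \<and>
        (AE \<omega> in M. vec_cond_exp M (past M g t) (g t) \<omega> = grad f (x t \<omega>)))"

text \<open>
  The conditional variance is taken in \<open>ennreal\<close>, so that an infinite variance
  is not turned into \<open>0\<close> and finiteness of second moments is part of the condition.
\<close>

definition variance_bounded_oracle ::
    "'a measure \<Rightarrow> real \<Rightarrow> (nat \<Rightarrow> 'a \<Rightarrow> 'b::euclidean_space) \<Rightarrow> nat \<Rightarrow> bool"
  where
  "variance_bounded_oracle M v g T \<longleftrightarrow>
     (\<forall>t\<in>{1..T}. AE \<omega> in M.
        nn_cond_exp M (past M g t)
          (\<lambda>\<omega>'. ennreal ((norm (g t \<omega>' - vec_cond_exp M (past M g t) (g t) \<omega>'))\<^sup>2)) \<omega> \<le> ennreal v)"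

text \<open>
  The index \<open>\<tau>\<close> is drawn with probabilities \<open>P\<close> on \<open>{1..T}\<close>,
  independently of the whole run \<open>g 1, \<dots>, g T\<close>.
\<close>

definition independent_random_index ::
    "'a measure \<Rightarrow> (nat \<Rightarrow> real) \<Rightarrow> (nat \<Rightarrow> 'a \<Rightarrow> 'b::euclidean_space) \<Rightarrow> nat \<Rightarrow> ('a \<Rightarrow> nat) \<Rightarrow> bool"
  where
  "independent_random_index M P g T \<tau> \<longleftrightarrow>
     \<tau> \<in> measurable M (count_space UNIV) \<and>
     (\<forall>\<omega>\<in>space M. \<tau> \<omega> \<in> {1..T}) \<and>
     (\<forall>t\<in>{1..T}. measure M {\<omega> \<in> space M. \<tau> \<omega> = t} = P t) \<and>
     prob_space.indep_set M
       (sets (vimage_algebra (space M) \<tau> (count_space UNIV))) (sets (past M g (Suc T)))"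

end

theory Submission
  imports Defs
begin

text \<open>
  Since \<open>f\<close> is bounded and smooth, \<open>grad f\<close> is bounded, so all expectations below are finite.
  The descent inequality and \<open>\<eta>\<^sub>t \<le> 1 / L\<close> give
  \<open>E |grad f x\<^sub>t|\<^sup>2 / \<eta>\<^sub>t \<le> 2 (E f x\<^sub>t - E f x\<^sub>t\<^sub>+\<^sub>1) / \<eta>\<^sub>t\<^sup>2 + L V\<^sup>2\<close>. The weights \<open>1 / \<eta>\<^sub>t\<^sup>2\<close> increase, so
  summation by parts bounds the sum of the first terms by \<open>2 / \<eta>\<^sub>T\<^sup>2\<close> times the oscillation of \<open>f\<close>,
  and \<open>\<alpha>\<^sup>T = T / \<beta>\<close>. The random index turns the left-hand side into the expected squared gradient
  times \<open>\<Sum> 1 / \<eta>\<^sub>l\<close>, a geometric sum that is estimated from below by \<open>1 - 1 / \<alpha> \<le> ln \<alpha>\<close>.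
\<close>

section \<open>Consequences of smoothness: descent inequality, bounded gradient,
  measurability\<close>

text \<open>Along the segment from \<open>x\<close> to \<open>x + v\<close>, the Lipschitz bound on
  the gradient and Cauchy-Schwarz limit the growth of the directional derivative to
  \<open>L * s * (norm v)^2\<close>. A monotonicity argument then replaces integration over the
  segment.\<close>

lemma smooth_on_space_descent:
  fixes f :: "'a::euclidean_space \<Rightarrow> real"
  assumes "smooth_on_space L f"
  shows "f (x + v) \<le> f x + v \<bullet> grad f x + L / 2 * (norm v)\<^sup>2"
proof -
  \<comment> \<open>\<open>p\<close> is \<open>f\<close> on the segment minus the linear and
    quadratic terms of the claim, so \<open>p 0 = f x\<close> and \<open>p 1 \<le> p 0\<close> is
    the claim itself.\<close>
  define p where "p s = f (x + s *\<^sub>R v) - s * (v \<bullet> grad f x) - L / 2 * s\<^sup>2 * (norm v)\<^sup>2" for s :: real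
  have "p 1 \<le> p 0"
  proof (rule DERIV_nonpos_imp_nonincreasing[where f = p])
    fix s :: real assume s: "0 \<le> s" "s \<le> 1"
    let ?D = "v \<bullet> grad f (x + s *\<^sub>R v) - v \<bullet> grad f x - L * s * (norm v)\<^sup>2"
    have "f differentiable (at (x + s *\<^sub>R v))"
      using assms by (simp add: smooth_on_space_def)
    then have f: "(f has_derivative (\<lambda>h. h \<bullet> grad f (x + s *\<^sub>R v))) (at (x + s *\<^sub>R v))"
      using GDERIV_grad by (auto simp: gderiv_def)
    have "((\<lambda>s. x + s *\<^sub>R v) has_derivative (\<lambda>h. h *\<^sub>R v)) (at s)"
      by (auto intro!: derivative_eq_intros)
    then have "((\<lambda>s. f (x + s *\<^sub>R v)) has_derivative
        (\<lambda>h. (h *\<^sub>R v) \<bullet> grad f (x + s *\<^sub>R v))) (at s)"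
      by (rule has_derivative_compose) (rule f)
    then have "((\<lambda>s. f (x + s *\<^sub>R v)) has_real_derivative v \<bullet> grad f (x + s *\<^sub>R v)) (at s)"
      by (rule has_derivative_imp_has_field_derivative) simp
    then have "(p has_real_derivative ?D) (at s)"
      unfolding p_def by (auto intro!: derivative_eq_intros)
    moreover have "?D \<le> 0"
    proof -
      have "v \<bullet> grad f (x + s *\<^sub>R v) - v \<bullet> grad f x
          \<le> norm v * norm (grad f (x + s *\<^sub>R v) - grad f x)"
        unfolding inner_diff_right[symmetric] by (rule norm_cauchy_schwarz)
      also have "\<dots> \<le> norm v * (L * norm (x + s *\<^sub>R v - x))"
        using assms by (intro mult_left_mono) (simp_all only: smooth_on_space_def norm_ge_zero)
      also have "\<dots> = L * s * (norm v)\<^sup>2"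
        using s by (simp add: power2_eq_square)
      finally show ?thesis
        by simp
    qed
    ultimately show "\<exists>y. DERIV p s :> y \<and> y \<le> 0"
      by blast
  qed simp
  then show ?thesis
    by (simp add: p_def)
qed

lemma smooth_on_space_norm_grad_le:
  fixes f :: "'a::euclidean_space \<Rightarrow> real"
  assumes "smooth_on_space L f" "L > 0" and lower: "\<And>y. m \<le> f y"
  shows "(norm (grad f x))\<^sup>2 \<le> 2 * L * (f x - m)"
proof -
  txt \<open>Compare with the minimizer of the quadratic upper model of \<open>f\<close> at \<open>x\<close>.\<close>
  have "m \<le> f (x + (- 1 / L) *\<^sub>R grad f x)"
    by (rule lower)
  also have "\<dots> \<le> f x + ((- 1 / L) *\<^sub>R grad f x) \<bullet> grad f x
      + L / 2 * (norm ((- 1 / L) *\<^sub>R grad f x))\<^sup>2"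
    by (rule smooth_on_space_descent[OF assms(1)])
  also have "\<dots> = f x - (norm (grad f x))\<^sup>2 / (2 * L)"
    using \<open>L > 0\<close> by (simp add: power2_norm_eq_inner[symmetric] power_divide) (simp add: field_simps power2_eq_square)
  finally show ?thesis
    using \<open>L > 0\<close> by (simp add: field_simps)
qed

text \<open>The bound is uniform in \<open>x\<close>, so gradients at random iterates are bounded
  random variables.\<close>

lemma smooth_on_space_norm_grad_bounded:
  fixes f :: "'a::euclidean_space \<Rightarrow> real"
  assumes "smooth_on_space L f" "L > 0" and "\<And>y. m \<le> f y" and upper: "\<And>y. f y \<le> B"
  shows "(norm (grad f x))\<^sup>2 \<le> 2 * L * (B - m)"
proof -
  have "(norm (grad f x))\<^sup>2 \<le> 2 * L * (f x - m)"
    by (rule smooth_on_space_norm_grad_le[OF assms(1-3)])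
  also have "\<dots> \<le> 2 * L * (B - m)"
    using upper[of x] \<open>L > 0\<close> by (intro mult_left_mono) auto
  finally show ?thesis .
qed

lemma smooth_on_space_measurable:
  fixes f :: "'a::euclidean_space \<Rightarrow> real"
  assumes "smooth_on_space L f" "L > 0"
  shows "f \<in> borel_measurable borel" and "grad f \<in> borel_measurable borel"
proof -
  have "continuous_on UNIV f"
    using assms(1)
    by (auto simp: smooth_on_space_def intro!: continuous_at_imp_continuous_on differentiable_imp_continuous_within)
  then show "f \<in> borel_measurable borel"
    by (rule borel_measurable_continuous_onI)
  have "L-lipschitz_on UNIV (grad f)"
    using assms by (intro lipschitz_onI) (auto simp: smooth_on_space_def dist_norm)
  then have "continuous_on UNIV (grad f)"
    by (rule lipschitz_on_continuous_on)
  then show "grad f \<in> borel_measurable borel"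
    by (rule borel_measurable_continuous_onI)
qed

section \<open>The filtration generated by the oracle answers\<close>

lemma space_past [simp]: "space (past M g t) = space M"
  by (simp add: past_def space_measure_of_conv)

lemma sets_past:
  "sets (past M g t) =
    sigma_sets (space M) (\<Union>i\<in>{1..<t}. {g i -` A \<inter> space M | A. A \<in> sets borel})"
  unfolding past_def by (rule sets_measure_of) auto

lemma measurable_past:
  fixes g :: "nat \<Rightarrow> 'a \<Rightarrow> 'b::euclidean_space"
  assumes "1 \<le> i" "i < t"
  shows "g i \<in> borel_measurable (past M g t)"
proof (rule measurableI)
  fix A :: "'b set" assume "A \<in> sets borel"
  then have "g i -` A \<inter> space M \<in> (\<Union>i\<in>{1..<t}. {g i -` A \<inter> space M | A. A \<in> sets borel})"
    using assms by (intro UN_I[of i]) auto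
  then show "g i -` A \<inter> space (past M g t) \<in> sets (past M g t)"
    by (simp add: sets_past sigma_sets.Basic)
qed simp

lemma subalgebra_past_mono:
  assumes "s \<le> t"
  shows "subalgebra (past M g t) (past M g s)"
  unfolding subalgebra_def sets_past using assms
  by (intro conjI sigma_sets_mono' UN_mono) auto

lemma measurable_past_mono:
  assumes "X \<in> measurable (past M g s) N" "s \<le> t"
  shows "X \<in> measurable (past M g t) N"
  by (rule measurable_from_subalg[OF subalgebra_past_mono[OF assms(2)] assms(1)])

lemma subalgebra_past_oracle:
  assumes "unbiased_oracle M f x g T" "t \<le> Suc T"
  shows "subalgebra M (past M g t)"
proof (rule subalgebra_past)
  fix i assume "1 \<le> i" "i < t"
  then have "integrable M (g i)"
    using assms by (auto simp: unbiased_oracle_def)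
  then show "g i \<in> borel_measurable M"
    by (rule borel_measurable_integrable)
qed

text \<open>\<open>past M g (Suc n)\<close> is the first past that contains \<open>g n\<close>, and
  the update to \<open>x (Suc n)\<close> uses just \<open>x n\<close> and \<open>g n\<close>; so
  every iterate is known before its own query. The range reaches \<open>Suc T\<close> because the
  last update produces \<open>x (Suc T)\<close>.\<close>

lemma measurable_past_iterate:
  fixes g :: "nat \<Rightarrow> 'a \<Rightarrow> 'b::euclidean_space"
  assumes "\<And>\<omega>. \<omega> \<in> space M \<Longrightarrow> x 1 \<omega> = x1"
    and "\<And>t \<omega>. t \<in> {1..T} \<Longrightarrow> \<omega> \<in> space M \<Longrightarrow> x (Suc t) \<omega> = x t \<omega> - \<eta> t *\<^sub>R g t \<omega>"
    and "1 \<le> t" "t \<le> Suc T"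
  shows "x t \<in> borel_measurable (past M g t)"
  using assms(3,4)
proof (induction t rule: dec_induct)
  case base
  show ?case
    using assms(1) by (subst measurable_cong[of _ _ "\<lambda>_. x1"]) auto
next
  case (step n)
  then have "x n \<in> borel_measurable (past M g n)"
    by auto
  then have "x n \<in> borel_measurable (past M g (Suc n))"
    by (rule measurable_past_mono) simp
  moreover have "g n \<in> borel_measurable (past M g (Suc n))"
    using step by (intro measurable_past) auto
  ultimately have "(\<lambda>\<omega>. x n \<omega> - \<eta> n *\<^sub>R g n \<omega>) \<in> borel_measurable (past M g (Suc n))"
    by measurable
  then show ?case
    using assms(2) step by (subst measurable_cong[of _ _ "\<lambda>\<omega>. x n \<omega> - \<eta> n *\<^sub>R g n \<omega>"]) auto
qed

section \<open>Conditional moments of the oracle and the expected one-step decrease\<close>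

lemma vec_cond_exp_inner_Basis:
  "b \<in> Basis \<Longrightarrow> vec_cond_exp M F X \<omega> \<bullet> b = real_cond_exp M F (\<lambda>\<omega>'. X \<omega>' \<bullet> b) \<omega>"
  by (simp add: vec_cond_exp_def inner_sum_left_Basis)

text \<open>\<open>|G|\<^sup>2 = |G - Y|\<^sup>2 + 2 (Y \<bullet> G) - |Y|\<^sup>2\<close> reduces the second moment to the conditional variance.\<close>

lemma (in prob_space)
  fixes G Y :: "'a \<Rightarrow> 'b::euclidean_space"
  assumes F: "subalgebra M F" and G [measurable]: "integrable M G"
    and YF: "Y \<in> borel_measurable F" and YC: "\<And>\<omega>. \<omega> \<in> space M \<Longrightarrow> norm (Y \<omega>) \<le> C"
    and mean: "AE \<omega> in M. vec_cond_exp M F G \<omega> = Y \<omega>"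
    and var: "AE \<omega> in M. nn_cond_exp M F
        (\<lambda>\<omega>'. ennreal ((norm (G \<omega>' - vec_cond_exp M F G \<omega>'))\<^sup>2)) \<omega> \<le> ennreal v"
    and "v \<ge> 0"
  shows integrable_inner_cond_mean: "integrable M (\<lambda>\<omega>. Y \<omega> \<bullet> G \<omega>)"
    and integral_inner_cond_mean: "(\<integral>\<omega>. Y \<omega> \<bullet> G \<omega> \<partial>M) = (\<integral>\<omega>. (norm (Y \<omega>))\<^sup>2 \<partial>M)"
    and integrable_cond_second_moment: "integrable M (\<lambda>\<omega>. (norm (G \<omega>))\<^sup>2)"
    and integral_cond_second_moment_le:
      "(\<integral>\<omega>. (norm (G \<omega>))\<^sup>2 \<partial>M) \<le> (\<integral>\<omega>. (norm (Y \<omega>))\<^sup>2 \<partial>M) + v"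
proof -
  interpret finite_measure_subalgebra M F
    by unfold_locales (rule F)
  have YM [measurable]: "Y \<in> borel_measurable M"
    by (rule measurable_from_subalg[OF F YF])
  have Y2: "integrable M (\<lambda>\<omega>. (norm (Y \<omega>))\<^sup>2)"
  proof (rule integrable_const_bound[where B = "C\<^sup>2"])
    show "AE \<omega> in M. norm ((norm (Y \<omega>))\<^sup>2) \<le> C\<^sup>2"
      using YC by (intro AE_I2) (auto intro!: power_mono)
  qed measurable
  \<comment> \<open>The conditional mean is defined by coordinates, so the known factor is pulled
    out in each coordinate: \<open>E[Y_b G_b] = E[Y_b E[G_b | F]] = E[Y_b^2]\<close>. Boundedness of
    \<open>Y\<close> makes the product integrable before any second moment of \<open>G\<close> is
    available.\<close>
  have comp: "integrable M (\<lambda>\<omega>. (Y \<omega> \<bullet> b) * (G \<omega> \<bullet> b)) \<and>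
      (\<integral>\<omega>. (Y \<omega> \<bullet> b) * (G \<omega> \<bullet> b) \<partial>M) = (\<integral>\<omega>. (Y \<omega> \<bullet> b) * (Y \<omega> \<bullet> b) \<partial>M) \<and>
      integrable M (\<lambda>\<omega>. (Y \<omega> \<bullet> b) * (Y \<omega> \<bullet> b))"
    if b: "b \<in> Basis" for b
  proof -
    have int: "integrable M (\<lambda>\<omega>. (Y \<omega> \<bullet> b) * (G \<omega> \<bullet> b))"
    proof (rule Bochner_Integration.integrable_bound)
      show "integrable M (\<lambda>\<omega>. C * norm (G \<omega>))"
        using G by simp
      have "norm ((Y \<omega> \<bullet> b) * (G \<omega> \<bullet> b)) \<le> norm (C * norm (G \<omega>))" if "\<omega> \<in> space M" for \<omega>
        unfolding norm_mult
      proof (rule mult_mono)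
        show "norm (Y \<omega> \<bullet> b) \<le> norm C"
          using Basis_le_norm[OF b, of "Y \<omega>"] YC[OF that] by simp
        show "norm (G \<omega> \<bullet> b) \<le> norm (norm (G \<omega>))"
          using Basis_le_norm[OF b, of "G \<omega>"] by simp
      qed auto
      then show "AE \<omega> in M. norm ((Y \<omega> \<bullet> b) * (G \<omega> \<bullet> b)) \<le> norm (C * norm (G \<omega>))"
        by (rule AE_I2)
    qed measurable
    have YbF: "(\<lambda>\<omega>. Y \<omega> \<bullet> b) \<in> borel_measurable F"
      using YF by simp
    have "(\<lambda>\<omega>. G \<omega> \<bullet> b) \<in> borel_measurable M"
      using G by simp
    note ce = real_cond_exp_intg[OF int YbF this]
    have ae: "AE \<omega> in M. real_cond_exp M F (\<lambda>\<omega>. G \<omega> \<bullet> b) \<omega> = Y \<omega> \<bullet> b"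
      using mean by eventually_elim (metis vec_cond_exp_inner_Basis[OF b])
    have "(\<integral>\<omega>. (Y \<omega> \<bullet> b) * real_cond_exp M F (\<lambda>\<omega>. G \<omega> \<bullet> b) \<omega> \<partial>M)
        = (\<integral>\<omega>. (Y \<omega> \<bullet> b) * (Y \<omega> \<bullet> b) \<partial>M)"
      using ae by (intro integral_cong_AE) auto
    moreover have "integrable M (\<lambda>\<omega>. (Y \<omega> \<bullet> b) * (Y \<omega> \<bullet> b))"
      using ae by (intro integrable_cong_AE_imp[OF ce(1)]) auto
    ultimately show ?thesis
      using int ce by simp
  qed
  show inner_int: "integrable M (\<lambda>\<omega>. Y \<omega> \<bullet> G \<omega>)"
    unfolding euclidean_inner[of "Y _" "G _"] using comp by (intro Bochner_Integration.integrable_sum) auto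
  show inner_eq: "(\<integral>\<omega>. Y \<omega> \<bullet> G \<omega> \<partial>M) = (\<integral>\<omega>. (norm (Y \<omega>))\<^sup>2 \<partial>M)"
    unfolding euclidean_inner[of "Y _" "G _"] power2_norm_eq_inner euclidean_inner[of "Y _" "Y _"]
    using comp by (simp add: Bochner_Integration.integral_sum)
  define N where "N \<omega> = G \<omega> - Y \<omega>" for \<omega>
  have NM [measurable]: "N \<in> borel_measurable M"
    unfolding N_def by measurable
  have [measurable]: "vec_cond_exp M F G \<in> borel_measurable M"
    unfolding vec_cond_exp_def by measurable
  let ?h = "\<lambda>\<omega>. ennreal ((norm (G \<omega> - vec_cond_exp M F G \<omega>))\<^sup>2)"
  \<comment> \<open>The noise \<open>N\<close> is first handled in \<open>ennreal\<close>: total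
    expectation, with the constant weight 1, integrates the conditional variance bound. The
    resulting finite bound then proves that the squared noise is integrable.\<close>
  have "(\<integral>\<^sup>+\<omega>. ennreal ((norm (N \<omega>))\<^sup>2) \<partial>M) = (\<integral>\<^sup>+\<omega>. ?h \<omega> \<partial>M)"
    using mean by (intro nn_integral_cong_AE) (auto simp: N_def)
  also have "\<dots> = (\<integral>\<^sup>+\<omega>. nn_cond_exp M F ?h \<omega> \<partial>M)"
    using nn_cond_exp_intg[of "\<lambda>_. 1" ?h] by simp
  also have "\<dots> \<le> (\<integral>\<^sup>+\<omega>. ennreal v \<partial>M)"
    using var by (rule nn_integral_mono_AE)
  also have "\<dots> = ennreal v"
    by (simp add: emeasure_space_1)
  finally have N: "(\<integral>\<^sup>+\<omega>. ennreal ((norm (N \<omega>))\<^sup>2) \<partial>M) \<le> ennreal v" .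
  have N2: "integrable M (\<lambda>\<omega>. (norm (N \<omega>))\<^sup>2)"
    using N by (intro integrableI_nonneg) (auto simp: top.not_eq_extremum le_less_trans[OF _ ennreal_less_top])
  have Nv: "(\<integral>\<omega>. (norm (N \<omega>))\<^sup>2 \<partial>M) \<le> v"
    using N \<open>v \<ge> 0\<close> by (subst (asm) nn_integral_eq_integral[OF N2]) auto
  have G2: "(norm (G \<omega>))\<^sup>2 = (norm (N \<omega>))\<^sup>2 + 2 * (Y \<omega> \<bullet> G \<omega>) - (norm (Y \<omega>))\<^sup>2" for \<omega>
    by (simp add: N_def power2_norm_eq_inner inner_diff_left inner_diff_right inner_commute)
  show "integrable M (\<lambda>\<omega>. (norm (G \<omega>))\<^sup>2)"
    unfolding G2 using N2 inner_int Y2 by auto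
  show "(\<integral>\<omega>. (norm (G \<omega>))\<^sup>2 \<partial>M) \<le> (\<integral>\<omega>. (norm (Y \<omega>))\<^sup>2 \<partial>M) + v"
    unfolding G2 using N2 inner_int Y2 inner_eq Nv by simp
qed


lemma (in finite_measure) integrable_bounded_compose:
  fixes f :: "'b::topological_space \<Rightarrow> real"
  assumes [measurable]: "f \<in> borel_measurable borel" "Z \<in> borel_measurable M"
    and "\<And>y. m \<le> f y" "\<And>y. f y \<le> B"
  shows "integrable M (\<lambda>\<omega>. f (Z \<omega>))"
proof (rule integrable_const_bound[where B = "\<bar>m\<bar> + \<bar>B\<bar>"])
  have "\<bar>f y\<bar> \<le> \<bar>m\<bar> + \<bar>B\<bar>" for y
    using assms(3)[of y] assms(4)[of y] by linarith
  then show "AE \<omega> in M. norm (f (Z \<omega>)) \<le> \<bar>m\<bar> + \<bar>B\<bar>"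
    by simp
qed measurable

text \<open>Take expectations in the descent inequality at \<open>v = - \<eta> G\<close>. The linear
  term yields \<open>- \<eta>\<close> times the expected squared gradient, and the quadratic term
  costs \<open>L \<eta>^2 / 2\<close> times that quantity plus the variance.\<close>

lemma (in prob_space) expected_descent_step:
  fixes f :: "'b::euclidean_space \<Rightarrow> real" and X G :: "'a \<Rightarrow> 'b"
  assumes smooth: "smooth_on_space L f" "L > 0"
    and lower: "\<And>y. m \<le> f y" and upper: "\<And>y. f y \<le> B"
    and F: "subalgebra M F" and G: "integrable M G" and XF: "X \<in> borel_measurable F"
    and mean: "AE \<omega> in M. vec_cond_exp M F G \<omega> = grad f (X \<omega>)"
    and var: "AE \<omega> in M. nn_cond_exp M F
        (\<lambda>\<omega>'. ennreal ((norm (G \<omega>' - vec_cond_exp M F G \<omega>'))\<^sup>2)) \<omega> \<le> ennreal v"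
    and "v \<ge> 0" and \<eta>: "\<eta> \<ge> 0" "\<eta> * L \<le> 1"
  shows "\<eta> / 2 * (\<integral>\<omega>. (norm (grad f (X \<omega>)))\<^sup>2 \<partial>M)
    \<le> (\<integral>\<omega>. f (X \<omega>) \<partial>M) - (\<integral>\<omega>. f (X \<omega> - \<eta> *\<^sub>R G \<omega>) \<partial>M) + L * \<eta>\<^sup>2 / 2 * v"
proof -
  note [measurable] = smooth_on_space_measurable[OF smooth] G
  have X [measurable]: "X \<in> borel_measurable M"
    by (rule measurable_from_subalg[OF F XF])
  have C: "norm (grad f y) \<le> sqrt (2 * L * (B - m))" for y
    by (rule real_le_rsqrt[OF smooth_on_space_norm_grad_bounded[OF smooth lower upper]])
  have "(\<lambda>\<omega>. grad f (X \<omega>)) \<in> borel_measurable F"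
    by (rule measurable_compose[OF XF smooth_on_space_measurable(2)[OF smooth]])
  \<comment> \<open>The moment lemmas are used with \<open>Y\<close> the gradient at
    \<open>X\<close>, which is \<open>F\<close>-measurable because \<open>X\<close> is.\<close>
  note moments = F G this C mean var \<open>v \<ge> 0\<close>
  note inner_int = integrable_inner_cond_mean[OF moments]
    and inner_eq = integral_inner_cond_mean[OF moments]
    and sq_int = integrable_cond_second_moment[OF moments]
    and sq_le = integral_cond_second_moment_le[OF moments]
  let ?E = "\<integral>\<omega>. (norm (grad f (X \<omega>)))\<^sup>2 \<partial>M"
  note f_int = integrable_bounded_compose[OF smooth_on_space_measurable(1)[OF smooth] _ lower upper]
  have X_int: "integrable M (\<lambda>\<omega>. f (X \<omega>))"
    by (rule f_int) measurable
  have "(\<integral>\<omega>. f (X \<omega> - \<eta> *\<^sub>R G \<omega>) \<partial>M)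
      \<le> (\<integral>\<omega>. f (X \<omega>) - \<eta> * (grad f (X \<omega>) \<bullet> G \<omega>) + L / 2 * \<eta>\<^sup>2 * (norm (G \<omega>))\<^sup>2 \<partial>M)"
  proof (rule integral_mono)
    show "integrable M (\<lambda>\<omega>. f (X \<omega> - \<eta> *\<^sub>R G \<omega>))"
      by (rule f_int) measurable
    show "integrable M (\<lambda>\<omega>. f (X \<omega>) - \<eta> * (grad f (X \<omega>) \<bullet> G \<omega>) + L / 2 * \<eta>\<^sup>2 * (norm (G \<omega>))\<^sup>2)"
      using X_int inner_int sq_int by auto
    show "f (X \<omega> - \<eta> *\<^sub>R G \<omega>)
        \<le> f (X \<omega>) - \<eta> * (grad f (X \<omega>) \<bullet> G \<omega>) + L / 2 * \<eta>\<^sup>2 * (norm (G \<omega>))\<^sup>2" for \<omega>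
      using smooth_on_space_descent[OF smooth(1), of "X \<omega>" "- \<eta> *\<^sub>R G \<omega>"]
      by (simp add: inner_commute power_mult_distrib mult.assoc)
  qed
  also have "\<dots> = (\<integral>\<omega>. f (X \<omega>) \<partial>M) - \<eta> * ?E + L / 2 * \<eta>\<^sup>2 * (\<integral>\<omega>. (norm (G \<omega>))\<^sup>2 \<partial>M)"
    using X_int inner_int sq_int inner_eq by simp
  also have "\<dots> \<le> (\<integral>\<omega>. f (X \<omega>) \<partial>M) - \<eta> * ?E + L / 2 * \<eta>\<^sup>2 * (?E + v)"
    using sq_le \<open>L > 0\<close> by (intro add_left_mono mult_left_mono) auto
  \<comment> \<open>Here \<open>\<eta> * L \<le> 1\<close> enters: the quadratic term consumes at
    most half of the linear decrease, which leaves the factor \<open>\<eta> / 2\<close>.\<close>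
  also have "L / 2 * \<eta>\<^sup>2 * (?E + v) \<le> \<eta> / 2 * ?E + L / 2 * \<eta>\<^sup>2 * v"
  proof -
    have "L / 2 * \<eta>\<^sup>2 \<le> \<eta> / 2"
      using mult_left_mono[OF \<eta>(2,1)] by (simp add: power2_eq_square ac_simps)
    then have "L / 2 * \<eta>\<^sup>2 * ?E \<le> \<eta> / 2 * ?E"
      by (intro mult_right_mono) auto
    then show ?thesis
      by (simp add: distrib_left)
  qed
  finally show ?thesis
    by (simp add: algebra_simps)
qed

section \<open>Summation by parts\<close>

text \<open>After summation by parts, each \<open>a (Suc t)\<close> with \<open>t < T\<close>
  carries the coefficient \<open>w (Suc t) - w t\<close>, which is nonnegative. Replacing every
  \<open>a\<close> by its upper bound \<open>W\<close> lets the coefficients telescope to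
  \<open>w T\<close>.\<close>

lemma weighted_telescope_le:
  fixes w a :: "nat \<Rightarrow> real"
  assumes "1 \<le> T" and "\<And>t. t \<in> {1..T} \<Longrightarrow> 0 \<le> w t"
    and "\<And>s t. 1 \<le> s \<Longrightarrow> s \<le> t \<Longrightarrow> t \<le> T \<Longrightarrow> w s \<le> w t"
    and "\<And>t. t \<in> {1..Suc T} \<Longrightarrow> 0 \<le> a t \<and> a t \<le> W"
  shows "(\<Sum>t=1..T. w t * (a t - a (Suc t))) \<le> w T * W"
proof -
  \<comment> \<open>The boundary term stays on the left so that the induction step only has to bound
    \<open>(w (Suc n) - w n) * a (Suc n)\<close>; at \<open>n = T\<close> it is nonnegative and is
    dropped.\<close>
  have "(\<Sum>t=1..n. w t * (a t - a (Suc t))) + w n * a (Suc n) \<le> w n * W" if "n \<le> T" "1 \<le> n" for n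
    using that(2,1)
  proof (induction n rule: dec_induct)
    case base
    have "w 1 * a 1 \<le> w 1 * W"
      using assms by (intro mult_left_mono) auto
    then show ?case
      by (simp add: algebra_simps)
  next
    case (step n)
    have "(w (Suc n) - w n) * a (Suc n) \<le> (w (Suc n) - w n) * W"
      using assms(3)[of n "Suc n"] assms(4)[of "Suc n"] step by (intro mult_left_mono) auto
    with step show ?case
      by (simp add: algebra_simps)
  qed
  from this[of T] show ?thesis
    using assms(1) assms(2)[of T] assms(4)[of "Suc T"] by (smt (verit) atLeastAtMost_iff le_SucI mult_nonneg_nonneg order_refl)
qed

section \<open>Averaging over the independent random index\<close>

lemma sigma_sets_vimage_subset:
  assumes "X \<in> measurable N S"
  shows "sigma_sets (space N) {X -` B \<inter> space N | B. B \<in> sets S} \<subseteq> sets N"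
  using assms by (intro sets.sigma_sets_subset) auto

text \<open>Split according to the value of the index: the event that it equals \<open>t\<close> is
  independent of \<open>h t\<close>, which is a function of the run, so each expectation
  factors.\<close>

lemma (in prob_space) integral_independent_random_index:
  fixes h :: "nat \<Rightarrow> 'a \<Rightarrow> real"
  assumes ind: "independent_random_index M P g T \<tau>"
    and meas: "\<And>t. t \<in> {1..T} \<Longrightarrow> h t \<in> borel_measurable (past M g (Suc T))"
    and int: "\<And>t. t \<in> {1..T} \<Longrightarrow> integrable M (h t)"
  shows "(\<integral>\<omega>. h (\<tau> \<omega>) \<omega> \<partial>M) = (\<Sum>t=1..T. P t * (\<integral>\<omega>. h t \<omega> \<partial>M))"
proof -
  define A where "A t = {\<omega> \<in> space M. \<tau> \<omega> = t}" for t
  let ?V = "vimage_algebra (space M) \<tau> (count_space UNIV)"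
  from ind have \<tau> [measurable]: "\<tau> \<in> measurable M (count_space UNIV)"
    and range: "\<And>\<omega>. \<omega> \<in> space M \<Longrightarrow> \<tau> \<omega> \<in> {1..T}"
    and P: "\<And>t. t \<in> {1..T} \<Longrightarrow> prob (A t) = P t"
    and indep: "indep_set (sets ?V) (sets (past M g (Suc T)))"
    by (auto simp: independent_random_index_def A_def)
  have A [measurable]: "A t \<in> sets M" for t
    unfolding A_def by measurable
  have AV: "A t \<in> sets ?V" for t
  proof -
    have "A t = \<tau> -` {t} \<inter> space M"
      by (auto simp: A_def)
    then show ?thesis
      by (simp add: in_vimage_algebra)
  qed
  have eq: "(\<integral>\<omega>. indicator (A t) \<omega> * h t \<omega> \<partial>M) = P t * (\<integral>\<omega>. h t \<omega> \<partial>M)"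
    and prod_int: "integrable M (\<lambda>\<omega>. indicator (A t) \<omega> * h t \<omega>)" if t: "t \<in> {1..T}" for t
  proof -
    have [measurable]: "h t \<in> borel_measurable M"
      using int[OF t] by (rule borel_measurable_integrable)
    \<comment> \<open>Independence is given for the full sigma-algebras; it passes to the smaller
      ones generated by the indicator and by \<open>h t\<close>.\<close>
    have "indicat_real (A t) \<in> borel_measurable ?V"
      using AV by measurable
    then have "sigma_sets (space M) {indicat_real (A t) -` B \<inter> space M | B. B \<in> sets borel} \<subseteq> sets ?V"
      using sigma_sets_vimage_subset[of _ ?V] by simp
    moreover have "sigma_sets (space M) {h t -` B \<inter> space M | B. B \<in> sets borel}
        \<subseteq> sets (past M g (Suc T))"
      using sigma_sets_vimage_subset[OF meas[OF t]] by simp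
    ultimately have "indep_var borel (indicat_real (A t)) borel (h t)"
      using indep unfolding indep_var_eq indep_sets2_eq by (auto 4 3)
    note indep_var_lebesgue_integral[OF this _ int[OF t]] indep_var_integrable[OF this _ int[OF t]]
    then show "(\<integral>\<omega>. indicator (A t) \<omega> * h t \<omega> \<partial>M) = P t * (\<integral>\<omega>. h t \<omega> \<partial>M)"
      and "integrable M (\<lambda>\<omega>. indicator (A t) \<omega> * h t \<omega>)"
      using P[OF t] A[of t] by (auto simp: integrable_indicator_iff emeasure_eq_measure)
  qed
  have "(\<integral>\<omega>. h (\<tau> \<omega>) \<omega> \<partial>M) = (\<integral>\<omega>. (\<Sum>t=1..T. indicator (A t) \<omega> * h t \<omega>) \<partial>M)"
  proof (rule Bochner_Integration.integral_cong)
    fix \<omega> assume \<omega>: "\<omega> \<in> space M"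
    \<comment> \<open>The index lies in \<open>{1..T}\<close> everywhere, so exactly one summand
      survives.\<close>
    then have "(\<Sum>t=1..T. indicator (A t) \<omega> * h t \<omega>) = (\<Sum>t\<in>{1..T}. if \<tau> \<omega> = t then h t \<omega> else 0)"
      by (intro sum.cong) (auto simp: A_def)
    then show "h (\<tau> \<omega>) \<omega> = (\<Sum>t=1..T. indicator (A t) \<omega> * h t \<omega>)"
      using range[OF \<omega>] by simp
  qed simp
  also have "\<dots> = (\<Sum>t=1..T. P t * (\<integral>\<omega>. h t \<omega> \<partial>M))"
    by (subst Bochner_Integration.integral_sum) (auto intro: prod_int simp: eq)
  finally show ?thesis .
qed

section \<open>The normalizing constant of the weights\<close>

text \<open>The logarithm is the convenient upper bound because \<open>\<alpha>\<close> will be a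
  \<open>T\<close>-th root of some \<open>\<rho>\<close>: \<open>ln \<alpha> = ln \<rho> / T\<close>
  supplies the factor \<open>1 / T\<close> of the final rate.\<close>

lemma inverse_geometric_sum_le:
  fixes \<alpha> :: real
  assumes "\<alpha> > 1" "T \<ge> 1"
  shows "1 / (\<Sum>l=1..T. \<alpha> ^ l) \<le> ln \<alpha> / (\<alpha> ^ T - 1)"
proof -
  have sum: "(\<Sum>l=1..T. \<alpha> ^ l) * (\<alpha> - 1) = \<alpha> * (\<alpha> ^ T - 1)"
    by (induction T) (auto simp: algebra_simps)
  have "\<alpha> ^ T > 1"
    using assms by (intro one_less_power) auto
  moreover have "(\<Sum>l=1..T. \<alpha> ^ l) > 0"
    using assms by (intro sum_pos) auto
  ultimately have "1 / (\<Sum>l=1..T. \<alpha> ^ l) = (\<alpha> - 1) / (\<alpha> * (\<alpha> ^ T - 1))"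
    using sum[symmetric] assms by simp
  also have "\<dots> = (1 - 1 / \<alpha>) / (\<alpha> ^ T - 1)"
    using assms by (simp add: field_simps)
  also have "1 - 1 / \<alpha> \<le> ln \<alpha>"
    using ln_le_minus_one[of "1 / \<alpha>"] assms by (simp add: ln_div)
  finally show ?thesis
    using \<open>\<alpha> ^ T > 1\<close> by (simp add: divide_right_mono)
qed


section \<open>Convergence bounds for SGD\<close>

lemma (in prob_space) sgd_weighted_gradient_bound:
  fixes f :: "'b::euclidean_space \<Rightarrow> real" and x g :: "nat \<Rightarrow> 'a \<Rightarrow> 'b"
  assumes smooth: "smooth_on_space L f" "L > 0"
    and lower: "\<And>y. m \<le> f y" and upper: "\<And>y. f y \<le> B"
    and start: "\<And>\<omega>. \<omega> \<in> space M \<Longrightarrow> x 1 \<omega> = x1"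
    and step: "\<And>t \<omega>. t \<in> {1..T} \<Longrightarrow> \<omega> \<in> space M \<Longrightarrow> x (Suc t) \<omega> = x t \<omega> - \<eta> t *\<^sub>R g t \<omega>"
    and unbiased: "unbiased_oracle M f x g T"
    and variance: "variance_bounded_oracle M v g T" "v \<ge> 0"
    and "T \<ge> 1"
    and pos: "\<And>t. t \<in> {1..T} \<Longrightarrow> 0 < \<eta> t" and small: "\<And>t. t \<in> {1..T} \<Longrightarrow> \<eta> t * L \<le> 1"
    and decr: "\<And>s t. 1 \<le> s \<Longrightarrow> s \<le> t \<Longrightarrow> t \<le> T \<Longrightarrow> \<eta> t \<le> \<eta> s"
  shows "(\<Sum>t=1..T. (\<integral>\<omega>. (norm (grad f (x t \<omega>)))\<^sup>2 \<partial>M) / \<eta> t)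
    \<le> 2 * (B - m) / (\<eta> T)\<^sup>2 + L * v * real T"
proof -
  note [measurable] = smooth_on_space_measurable[OF smooth]
  \<comment> \<open>Subtracting \<open>m\<close> puts the values into the interval from
    \<open>0\<close> to \<open>B - m\<close>, as summation by parts requires, and leaves the
    differences unchanged.\<close>
  define a where "a t = (\<integral>\<omega>. f (x t \<omega>) \<partial>M) - m" for t
  have sub: "subalgebra M (past M g t)" if "t \<in> {1..Suc T}" for t
    using unbiased that by (intro subalgebra_past_oracle) auto
  have xF: "x t \<in> borel_measurable (past M g t)" if "t \<in> {1..Suc T}" for t
    using that by (intro measurable_past_iterate[OF start step]) auto
  have a: "0 \<le> a t \<and> a t \<le> B - m" if t: "t \<in> {1..Suc T}" for t
  proof -
    have [measurable]: "x t \<in> borel_measurable M"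
      using sub[OF t] xF[OF t] by (rule measurable_from_subalg)
    have int: "integrable M (\<lambda>\<omega>. f (x t \<omega>))"
      by (rule integrable_bounded_compose[OF _ _ lower upper]) measurable
    have "m \<le> (\<integral>\<omega>. f (x t \<omega>) \<partial>M)"
      using int lower by (intro integral_ge_const) auto
    moreover have "(\<integral>\<omega>. f (x t \<omega>) \<partial>M) \<le> B"
      using int upper by (intro integral_le_const) auto
    ultimately show ?thesis
      by (simp add: a_def)
  qed
  have one_step: "(\<integral>\<omega>. (norm (grad f (x t \<omega>)))\<^sup>2 \<partial>M) / \<eta> t
      \<le> 2 / (\<eta> t)\<^sup>2 * (a t - a (Suc t)) + L * v" if t: "t \<in> {1..T}" for t
  proof -
    let ?E = "\<integral>\<omega>. (norm (grad f (x t \<omega>)))\<^sup>2 \<partial>M"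
    have "\<eta> t / 2 * ?E
        \<le> (\<integral>\<omega>. f (x t \<omega>) \<partial>M) - (\<integral>\<omega>. f (x t \<omega> - \<eta> t *\<^sub>R g t \<omega>) \<partial>M) + L * (\<eta> t)\<^sup>2 / 2 * v"
      using t unbiased variance pos[OF t] small[OF t] xF[of t] sub[of t]
      by (intro expected_descent_step[OF smooth lower upper, where F = "past M g t"])
        (auto simp: unbiased_oracle_def variance_bounded_oracle_def)
    also have "(\<integral>\<omega>. f (x t \<omega> - \<eta> t *\<^sub>R g t \<omega>) \<partial>M) = (\<integral>\<omega>. f (x (Suc t) \<omega>) \<partial>M)"
      using step[OF t] by (intro Bochner_Integration.integral_cong) auto
    finally have "\<eta> t / 2 * ?E \<le> a t - a (Suc t) + L * (\<eta> t)\<^sup>2 / 2 * v"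
      by (simp add: a_def)
    \<comment> \<open>The factor \<open>2 / \<eta>_t^2\<close> turns the gradient term into the
      weight \<open>1 / \<eta>_t\<close> of the random index and makes the noise term
      \<open>L * v\<close>, free of the step size.\<close>
    from mult_left_mono[OF this, of "2 / (\<eta> t)\<^sup>2"] show ?thesis
      using pos[OF t] by (simp add: field_simps power2_eq_square)
  qed
  have "(\<Sum>t=1..T. (\<integral>\<omega>. (norm (grad f (x t \<omega>)))\<^sup>2 \<partial>M) / \<eta> t)
      \<le> (\<Sum>t=1..T. 2 / (\<eta> t)\<^sup>2 * (a t - a (Suc t)) + L * v)"
    by (intro sum_mono one_step)
  also have "\<dots> = (\<Sum>t=1..T. 2 / (\<eta> t)\<^sup>2 * (a t - a (Suc t))) + L * v * real T"
    by (simp add: sum.distrib)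
  also have "(\<Sum>t=1..T. 2 / (\<eta> t)\<^sup>2 * (a t - a (Suc t))) \<le> 2 / (\<eta> T)\<^sup>2 * (B - m)"
  proof (rule weighted_telescope_le[OF \<open>T \<ge> 1\<close>])
    show "2 / (\<eta> s)\<^sup>2 \<le> 2 / (\<eta> t)\<^sup>2" if "1 \<le> s" "s \<le> t" "t \<le> T" for s t
      using that decr[OF that] pos[of s] pos[of t]
      by (intro divide_left_mono power_mono mult_pos_pos) auto
  qed (use a in auto)
  finally show ?thesis
    by simp
qed

text \<open>Here \<open>\<rho>\<close> stands for \<open>T / \<beta>\<close>, the total ratio by
  which the step size decays, and \<open>m\<close> is any lower bound of \<open>f\<close>, so that
  the caller can choose it.\<close>

lemma (in prob_space) sgd_exponential_step_bound:
  fixes f :: "'b::euclidean_space \<Rightarrow> real" and x g :: "nat \<Rightarrow> 'a \<Rightarrow> 'b"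
  assumes smooth: "smooth_on_space L f" "L > 0"
    and lower: "\<And>y. m \<le> f y" and upper: "\<And>y. f y \<le> B"
    and start: "\<And>\<omega>. \<omega> \<in> space M \<Longrightarrow> x 1 \<omega> = x1"
    and step: "\<And>t \<omega>. t \<in> {1..T} \<Longrightarrow> \<omega> \<in> space M \<Longrightarrow> x (Suc t) \<omega> = x t \<omega> - \<eta> t *\<^sub>R g t \<omega>"
    and unbiased: "unbiased_oracle M f x g T"
    and variance: "variance_bounded_oracle M v g T" "v \<ge> 0"
    and "T \<ge> 1" and "\<rho> > 1" and \<alpha>: "\<alpha> = \<rho> powr (1 / real T)"
    and \<eta>0: "0 < \<eta>0" "\<eta>0 \<le> 1 / L"
    and \<eta>: "\<And>t. t \<in> {1..T} \<Longrightarrow> \<eta> t = \<eta>0 / \<alpha> ^ t"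
    and P: "\<And>t. t \<in> {1..T} \<Longrightarrow> P t = (1 / \<eta> t) / (\<Sum>l=1..T. 1 / \<eta> l)"
    and ind: "independent_random_index M P g T \<tau>"
  shows "(\<integral>\<omega>. (norm (grad f (x (\<tau> \<omega>) \<omega>)))\<^sup>2 \<partial>M)
    \<le> \<eta>0 * ln \<rho> / ((\<rho> - 1) * real T) * (2 * (B - m) / \<eta>0\<^sup>2 * \<rho>\<^sup>2 + L * v * real T)"
proof -
  have "\<alpha> > 1"
    unfolding \<alpha> using \<open>\<rho> > 1\<close> \<open>T \<ge> 1\<close> by (intro gr_one_powr) auto
  have \<alpha>T: "\<alpha> ^ T = \<rho>"
    using \<open>\<rho> > 1\<close> \<open>T \<ge> 1\<close> unfolding \<alpha> by (simp add: powr_realpow[symmetric] powr_powr)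
  have ln\<alpha>: "ln \<alpha> = ln \<rho> / real T"
    using \<open>\<rho> > 1\<close> unfolding \<alpha> by (simp add: ln_powr)
  let ?e = "\<lambda>t. \<integral>\<omega>. (norm (grad f (x t \<omega>)))\<^sup>2 \<partial>M"
  define S where "S = (\<Sum>l=1..T. 1 / \<eta> l)"
  define R where "R = 2 * (B - m) / (\<eta> T)\<^sup>2 + L * v * real T"
  have S: "S = (\<Sum>l=1..T. \<alpha> ^ l) / \<eta>0"
    unfolding S_def by (simp add: \<eta> sum_divide_distrib)
  have "(\<Sum>l=1..T. \<alpha> ^ l) > 0"
    using \<open>\<alpha> > 1\<close> \<open>T \<ge> 1\<close> by (intro sum_pos) auto
  then have "S > 0"
    using \<eta>0 by (simp add: S)
  have "(\<integral>\<omega>. (norm (grad f (x (\<tau> \<omega>) \<omega>)))\<^sup>2 \<partial>M) = (\<Sum>t=1..T. P t * ?e t)"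
  proof (rule integral_independent_random_index[OF ind])
    fix t assume t: "t \<in> {1..T}"
    have sub: "subalgebra M (past M g (Suc T))"
      by (rule subalgebra_past_oracle[OF unbiased order_refl])
    have "x t \<in> borel_measurable (past M g t)"
      using t by (intro measurable_past_iterate[OF start step]) auto
    \<comment> \<open>Independence concerns the whole run, so measurability is enlarged from the
      past of query \<open>t\<close> to \<open>past M g (Suc T)\<close>.\<close>
    then have "x t \<in> borel_measurable (past M g (Suc T))"
      by (rule measurable_past_mono) (use t in simp)
    from measurable_compose[OF this smooth_on_space_measurable(2)[OF smooth]]
    show meas: "(\<lambda>\<omega>. (norm (grad f (x t \<omega>)))\<^sup>2) \<in> borel_measurable (past M g (Suc T))"
      by simp
    show "integrable M (\<lambda>\<omega>. (norm (grad f (x t \<omega>)))\<^sup>2)"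
    proof (rule integrable_const_bound[where B = "2 * L * (B - m)"])
      show "AE \<omega> in M. norm ((norm (grad f (x t \<omega>)))\<^sup>2) \<le> 2 * L * (B - m)"
        using smooth_on_space_norm_grad_bounded[OF smooth lower upper] by simp
    qed (rule measurable_from_subalg[OF sub meas])
  qed
  \<comment> \<open>The probabilities are \<open>1 / \<eta>_t\<close> normalized by
    \<open>S\<close>, so the average becomes the weighted gradient sum divided by
    \<open>S\<close>.\<close>
  also have "\<dots> = (\<Sum>t=1..T. ?e t / \<eta> t) / S"
    using P by (simp add: S_def sum_divide_distrib)
  also have "(\<Sum>t=1..T. ?e t / \<eta> t) \<le> R"
    unfolding R_def
  proof (rule sgd_weighted_gradient_bound[OF smooth lower upper start step unbiased variance \<open>T \<ge> 1\<close>])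
    show "0 < \<eta> t" if "t \<in> {1..T}" for t
      using \<eta>[OF that] \<eta>0 \<open>\<alpha> > 1\<close> by simp
    show "\<eta> t \<le> \<eta> s" if "1 \<le> s" "s \<le> t" "t \<le> T" for s t
      using that \<eta> \<eta>0 \<open>\<alpha> > 1\<close>
      by (auto intro!: divide_left_mono power_increasing mult_pos_pos)
    show "\<eta> t * L \<le> 1" if "t \<in> {1..T}" for t
    proof -
      have "\<eta> t \<le> \<eta>0"
        using \<eta>[OF that] \<eta>0 one_le_power[of \<alpha> t] \<open>\<alpha> > 1\<close> by (simp add: divide_le_eq)
      then show ?thesis
        using \<eta>0 \<open>L > 0\<close> by (simp add: pos_le_divide_eq) (smt (verit) mult_right_mono)
    qed
  qed
  also have "R / S = R * (\<eta>0 * (1 / (\<Sum>l=1..T. \<alpha> ^ l)))"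
    by (simp add: S)
  also have "\<dots> \<le> R * (\<eta>0 * (ln \<alpha> / (\<alpha> ^ T - 1)))"
  proof (intro mult_left_mono inverse_geometric_sum_le)
    \<comment> \<open>Nonnegativity allows multiplying the geometric estimate by \<open>R\<close>;
      it rests on \<open>m \<le> B\<close>, since \<open>f\<close> takes a value between
      them.\<close>
    show "0 \<le> R"
      using lower upper variance \<open>L > 0\<close> order_trans[OF lower upper] by (simp add: R_def)
  qed (use \<eta>0 \<open>\<alpha> > 1\<close> \<open>T \<ge> 1\<close> in auto)
  \<comment> \<open>The last step size is \<open>\<eta>0 / \<rho>\<close>, whence the factor
    \<open>\<rho>^2\<close>.\<close>
  also have "R = 2 * (B - m) / \<eta>0\<^sup>2 * \<rho>\<^sup>2 + L * v * real T"
    using \<open>T \<ge> 1\<close> by (simp add: R_def \<eta> \<alpha>T power_divide)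
  finally show ?thesis
    using \<open>S > 0\<close> by (simp add: divide_right_mono ln\<alpha> \<alpha>T ac_simps)
qed

text \<open>With \<open>s = sqrt T\<close> one has \<open>T / s = s\<close> and
  \<open>ln s = ln T / 2\<close>; both terms of the bracket contain \<open>s^2\<close>, which
  cancels the \<open>T\<close> in the denominator.\<close>

lemma sqrt_rate_eq:
  fixes T \<eta>0 W c :: real
  assumes "T > 1" "\<eta>0 > 0"
  shows "\<eta>0 * ln (T / sqrt T) / ((T / sqrt T - 1) * T) * (2 * W / \<eta>0\<^sup>2 * (T / sqrt T)\<^sup>2 + c * T)
    = (W / \<eta>0 + c * \<eta>0 / 2) * (ln T / (sqrt T - 1))"
proof -
  define s where "s = sqrt T"
  have s: "T = s\<^sup>2" "s > 1" "sqrt T = s"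
    using assms by (auto simp: s_def)
  have "T / s = s" "ln T = 2 * ln s"
    using s by (simp_all add: power2_eq_square ln_mult)
  with s assms(2) show ?thesis
    by (simp add: divide_simps) (simp add: algebra_simps power2_eq_square)
qed

text \<open>The gradient is unchanged when a constant is added to \<open>f\<close>, whereas
  \<open>f_max\<close> alone is not. The bounds with \<open>f_max\<close> are therefore stated for
  nonnegative \<open>f\<close>, and the shift-invariant ones with
  \<open>f_max - (INF y. f y)\<close> for every \<open>f\<close> bounded below.\<close>

theorem theorem3p4:
  fixes f :: "real ^ 'd \<Rightarrow> real"
    and L V f_max \<beta> \<alpha> \<eta>0 :: real
    and T :: nat
    and \<eta> P :: "nat \<Rightarrow> real"
    and M :: "'a measure"
    and x1 :: "real ^ 'd"
    and x g :: "nat \<Rightarrow> 'a \<Rightarrow> real ^ 'd"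
    and \<tau> :: "'a \<Rightarrow> nat"
  assumes "bdd_below (range f)"
    and "\<forall>y. f y \<le> f_max"
    and "L > 0"
    and "smooth_on_space L f"
    and "T > 1"
    and "1 \<le> \<beta>" and "\<beta> < real T"
    and "\<alpha> = (\<beta> / real T) powr (- 1 / real T)"
    and "0 < \<eta>0" and "\<eta>0 \<le> 1 / L"
    and "\<forall>t\<in>{1..T}. \<eta> t = \<eta>0 / \<alpha> ^ t"
    and "prob_space M"
    and "\<forall>\<omega>\<in>space M. x 1 \<omega> = x1"
    and "\<forall>t\<in>{1..T}. \<forall>\<omega>\<in>space M. x (Suc t) \<omega> = x t \<omega> - \<eta> t *\<^sub>R g t \<omega>"
    and "unbiased_oracle M f x g T"
    and "variance_bounded_oracle M (V\<^sup>2) g T"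
    and "\<forall>t\<in>{1..T}. P t = (1 / \<eta> t) / (\<Sum>l=1..T. 1 / \<eta> l)"
    and "independent_random_index M P g T \<tau>"
  shows
    "((\<forall>y. 0 \<le> f y) \<longrightarrow>
        (\<integral>\<omega>. (norm (grad f (x (\<tau> \<omega>) \<omega>)))\<^sup>2 \<partial>M)
          \<le> \<eta>0 * ln (real T / \<beta>) / ((real T / \<beta> - 1) * real T)
             * (2 * f_max / \<eta>0\<^sup>2 * (real T / \<beta>)\<^sup>2 + L * V\<^sup>2 * real T)
        \<and> (\<beta> = sqrt (real T) \<longrightarrow>
             (\<integral>\<omega>. (norm (grad f (x (\<tau> \<omega>) \<omega>)))\<^sup>2 \<partial>M)
               \<le> (f_max / \<eta>0 + L * V\<^sup>2 * \<eta>0 / 2) * (ln (real T) / (sqrt (real T) - 1))))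
     \<and> (\<integral>\<omega>. (norm (grad f (x (\<tau> \<omega>) \<omega>)))\<^sup>2 \<partial>M)
          \<le> \<eta>0 * ln (real T / \<beta>) / ((real T / \<beta> - 1) * real T)
             * (2 * (f_max - (INF y. f y)) / \<eta>0\<^sup>2 * (real T / \<beta>)\<^sup>2 + L * V\<^sup>2 * real T)
     \<and> (\<beta> = sqrt (real T) \<longrightarrow>
          (\<integral>\<omega>. (norm (grad f (x (\<tau> \<omega>) \<omega>)))\<^sup>2 \<partial>M)
            \<le> ((f_max - (INF y. f y)) / \<eta>0 + L * V\<^sup>2 * \<eta>0 / 2) * (ln (real T) / (sqrt (real T) - 1)))"
proof -
  interpret prob_space M by fact
  let ?E = "\<integral>\<omega>. (norm (grad f (x (\<tau> \<omega>) \<omega>)))\<^sup>2 \<partial>M"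
  let ?rhs = "\<lambda>W. \<eta>0 * ln (real T / \<beta>) / ((real T / \<beta> - 1) * real T)
    * (2 * W / \<eta>0\<^sup>2 * (real T / \<beta>)\<^sup>2 + L * V\<^sup>2 * real T)"
  have \<alpha>: "\<alpha> = (real T / \<beta>) powr (1 / real T)"
    using assms(5-8) by (simp add: powr_minus powr_divide inverse_eq_divide)
  have T: "real T / \<beta> > 1" "1 \<le> T"
    using assms(5-7) by simp_all
  \<comment> \<open>Keeping the lower bound \<open>m\<close> free serves both forms: the infimum in
    general and \<open>0\<close> for nonnegative \<open>f\<close>.\<close>
  have bound: "?E \<le> ?rhs (f_max - m)" if "\<And>y. m \<le> f y" for m
    by (rule sgd_exponential_step_bound[OF assms(4,3) _ _ _ _ assms(15,16) _ T(2,1) \<alpha> assms(9,10) _ _ assms(18)])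
      (use that assms(2,11,13,14,17) in \<open>blast intro: zero_le_power2\<close>)+
  have "(INF y. f y) \<le> f y" for y
    using assms(1) by (intro cINF_lower) auto
  then have inf: "?E \<le> ?rhs (f_max - (INF y. f y))"
    by (rule bound)
  have nonneg: "?E \<le> ?rhs f_max" if "\<forall>y. 0 \<le> f y"
    using bound[of 0] that by simp
  have rate: "?rhs W = (W / \<eta>0 + L * V\<^sup>2 * \<eta>0 / 2) * (ln (real T) / (sqrt (real T) - 1))"
    if "\<beta> = sqrt (real T)" for W
    unfolding that using assms(5,9) by (intro sqrt_rate_eq) auto
  show ?thesis
    by (intro conjI impI nonneg inf nonneg[THEN ord_le_eq_trans, OF _ rate] ord_le_eq_trans[OF inf rate])
qed

end
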